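(* Let $n,i,j,p$ be integers with $0<i<j\le n/2$ and $p\ge1$, such that either $i=1$ or neither $i$ nor $j$ is a unit in $\mathbb{Z}_n$. Assume $C_n(i,j)$ is connected (equivalently $\gcd(n,i,j)=1$) and $j<n/2$. For any $\alpha'\in\operatorname{Aut}(C_n(i,j))$, there is a unique $\alpha\in\operatorname{Aut}(C_n(i,j_\div p))$ such that $\alpha(u_a)=\alpha'(u_a)$ for all $a\in\mathbb{Z}_n$. If $\alpha'=(s,t)\in\mathbb{Z}_n\rtimes H'$, define $$\alpha(x)=\begin{cases}u_{s+ta}, & x=u_a,\\ v_{s+ta}^{r}, & x=v_a^r \text{ and } tj\equiv j,\\ v_{s+ta-j}^{(p+1)-r}, & x=v_a^r\text{ and } tj\equiv -j.\end{cases}$$ Then $\operatorname{Aut}(C_n(i,j_\div p))=\mathbb{Z}_n\rtimes H'$, with the action of elements of $\mathbb{Z}_n\rtimes H'$ as defined by this formula.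
   Context: Here $\equiv$ denotes congruence modulo $n$. $C_n(i,j)$ is the simple undirected graph with vertex set $\mathbb{Z}_n$ (the vertex $a$ is also written $u_a$) in which $a,b$ are adjacent if and only if $a-b\equiv\pm i$ or $a-b\equiv\pm j$. The subdivided graph $C_n(i,j_\div p)$ has vertices $u_a$ ($a\in\mathbb{Z}_n$) and $v_a^r$ ($a\in\mathbb{Z}_n$, $1\le r\le p$), with edges $u_au_{a+i}$ for all $a\in\mathbb{Z}_n$ and, for each $a\in\mathbb{Z}_n$, the edges of the path $(u_a,v_a^1,v_a^2,\dots,v_a^p,u_{a+j})$. $\operatorname{Aut}(G)$ is the automorphism group of a graph $G$. $U(n)$ is the group of units of $\mathbb{Z}_n$; $H$ is the subgroup of all $t\in U(n)$ such that multiplication by $t$ preserves the set $\{\pm i,\pm j\}$; and $H'$ is the subgroup of all $t\in H$ such that multiplication by $t$ preserves each of the sets $\{\pm i\}$ and $\{\pm j\}$. An element $(s,t)\in\mathbb{Z}_n\rtimes H'$ acts on $C_n(i,j)$ by $u_a\mapsto u_{s+ta}$, and multiplication in $\mathbb{Z}_n\rtimes H'$ is composition of these maps, $(s,t)(s',t')=(s+ts',tt')$.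
   Formalization: The claim that every α' in Aut(C_n(i,j)) extends is false (n=5, i=1, j=2, p=1, α': a↦2a). It is replaced by: each α' has at most one extension α, and one exists if and only if α' is the action of some (s,t) in Z_n⋊H'. *)

theory Defs
  imports
    "Graph_Theory.Graph_Theory"
    "HOL-Algebra.Bij"
    "HOL-Number_Theory.Residues"
begin

text \<open>
  \<open>\<int>\<^sub>n\<close> is the carrier \<open>{0..n - 1}\<close> of \<^const>\<open>residue_ring\<close>. A simple undirected
  graph is a finite, loop-free, symmetric digraph without parallel arcs (the locale
  \<^locale>\<open>pair_graph\<close>), so that each undirected edge is a pair of opposite arcs.
\<close>

definition aut_group :: "'a pair_pre_digraph \<Rightarrow> ('a \<Rightarrow> 'a) monoid" where
  "aut_group G = (BijGroup (pverts G))
     \<lparr>carrier := {f \<in> Bij (pverts G).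
        \<forall>x\<in>pverts G. \<forall>y\<in>pverts G. (f x, f y) \<in> parcs G \<longleftrightarrow> (x, y) \<in> parcs G}\<rparr>"

lemma group_aut_group: "group (aut_group G)"
proof -
  let ?S = "pverts G"
  let ?A = "carrier (aut_group G)"
  interpret B: group "BijGroup ?S" by (rule group_BijGroup)
  have cl: "compose ?S f g \<in> ?A" if "f \<in> ?A" "g \<in> ?A" for f g
    using that compose_Bij[of f ?S g] Bij_imp_funcset[of g ?S]
    by (auto simp: aut_group_def compose_def Pi_def)
  have inv: "restrict (inv_into ?S f) ?S \<in> ?A" if f: "f \<in> ?A" for f
  proof -
    have fB: "f \<in> Bij ?S" using f by (simp add: aut_group_def)
    have "(inv_into ?S f x, inv_into ?S f y) \<in> parcs G \<longleftrightarrow> (x, y) \<in> parcs G"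
      if "x \<in> ?S" "y \<in> ?S" for x y
    proof -
      have "f (inv_into ?S f x) = x" "f (inv_into ?S f y) = y"
        using fB that by (auto simp: Bij_def bij_betw_def f_inv_into_f)
      moreover have "inv_into ?S f x \<in> ?S" "inv_into ?S f y \<in> ?S"
        using fB that by (auto intro: Bij_inv_into_mem)
      ultimately show ?thesis using f unfolding aut_group_def by force
    qed
    then show ?thesis using restrict_inv_into_Bij[OF fB] by (simp add: aut_group_def)
  qed
  have sub: "?A \<subseteq> Bij ?S" by (auto simp: aut_group_def)
  have "subgroup ?A (BijGroup ?S)"
  proof (rule B.subgroupI)
    show "?A \<subseteq> carrier (BijGroup ?S)" using sub by (simp add: BijGroup_def)
    show "?A \<noteq> {}" using id_Bij[of ?S] by (auto simp: aut_group_def)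
  next
    fix f assume f: "f \<in> ?A"
    then have "inv\<^bsub>BijGroup ?S\<^esub> f = restrict (inv_into ?S f) ?S"
      using sub inv_BijGroup by blast
    then show "inv\<^bsub>BijGroup ?S\<^esub> f \<in> ?A" using inv[OF f] by simp
  next
    fix f g assume "f \<in> ?A" "g \<in> ?A"
    then show "f \<otimes>\<^bsub>BijGroup ?S\<^esub> g \<in> ?A"
      using cl sub by (auto simp: BijGroup_def)
  qed
  then have "group ((BijGroup ?S)\<lparr>carrier := ?A\<rparr>)"
    by (rule subgroup.subgroup_is_group) (rule group_BijGroup)
  then show ?thesis by (simp add: aut_group_def)
qed

definition circulant :: "int \<Rightarrow> int \<Rightarrow> int \<Rightarrow> int pair_pre_digraph" where
  "circulant n i j =
    \<lparr>pverts = carrier (residue_ring n),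
     parcs = {(a, b). a \<in> carrier (residue_ring n) \<and> b \<in> carrier (residue_ring n) \<and>
       ([a - b = i] (mod n) \<or> [a - b = - i] (mod n) \<or>
        [a - b = j] (mod n) \<or> [a - b = - j] (mod n))}\<rparr>"

lemma pair_graph_circulant:
  assumes "0 < i" "i < j" "2 * j < n"
  shows "pair_graph (circulant n i j)"
proof
  have fin: "finite (carrier (residue_ring n))" by (simp add: residue_ring_def)
  show "finite (pverts (circulant n i j))" using fin by (simp add: circulant_def)
  have "parcs (circulant n i j) \<subseteq> carrier (residue_ring n) \<times> carrier (residue_ring n)"
    by (auto simp: circulant_def)
  then show "finite (parcs (circulant n i j))" using fin finite_subset by blast
  show "fst e \<in> pverts (circulant n i j)" "snd e \<in> pverts (circulant n i j)"
    if "e \<in> parcs (circulant n i j)" for e using that by (auto simp: circulant_def)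
  have nd: "\<not> n dvd i" "\<not> n dvd j" using assms zdvd_not_zless by auto
  show "fst e \<noteq> snd e" if "e \<in> parcs (circulant n i j)" for e
    using that nd by (auto simp: circulant_def cong_iff_dvd_diff)
  have *: "[b - a = k] (mod n)" if "[a - b = - k] (mod n)" for a b k
    using that cong_minus_minus_iff[of "a - b" "- k" n] by simp
  have "sym (parcs (circulant n i j))"
  proof (rule symI)
    fix a b assume "(a, b) \<in> parcs (circulant n i j)"
    then show "(b, a) \<in> parcs (circulant n i j)"
      using *[of a b i] *[of a b j] *[of a b "- i"] *[of a b "- j"]
      by (auto simp: circulant_def)
  qed
  then show "symmetric (circulant n i j)" by (simp add: symmetric_def)
qed

text \<open>The vertex \<open>u\<^sub>a\<close> is \<open>U a\<close> and the vertex \<open>v\<^sub>a\<^sup>r\<close> is \<open>V a r\<close>.\<close>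

datatype subdiv_vertex = U int | V int int

text \<open>
  \<open>subdiv_path n j p a 0, ..., subdiv_path n j p a (p + 1)\<close> is the path
  \<open>(u\<^sub>a, v\<^sub>a\<^sup>1, ..., v\<^sub>a\<^sup>p, u\<^sub>a\<^sub>+\<^sub>j)\<close>.
\<close>

definition subdiv_path :: "int \<Rightarrow> int \<Rightarrow> int \<Rightarrow> int \<Rightarrow> int \<Rightarrow> subdiv_vertex" where
  "subdiv_path n j p a r =
     (if r = 0 then U a else if r = p + 1 then U ((a + j) mod n) else V a r)"

definition subdiv_edges :: "int \<Rightarrow> int \<Rightarrow> int \<Rightarrow> int \<Rightarrow> subdiv_vertex rel" where
  "subdiv_edges n i j p =
     {(U a, U ((a + i) mod n)) | a. a \<in> carrier (residue_ring n)} \<union>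
     {(subdiv_path n j p a r, subdiv_path n j p a (r + 1)) | a r.
        a \<in> carrier (residue_ring n) \<and> r \<in> {0..p}}"

definition subdiv_circulant :: "int \<Rightarrow> int \<Rightarrow> int \<Rightarrow> int \<Rightarrow> subdiv_vertex pair_pre_digraph" where
  "subdiv_circulant n i j p =
    \<lparr>pverts = U ` carrier (residue_ring n) \<union>
       {V a r | a r. a \<in> carrier (residue_ring n) \<and> r \<in> {1..p}},
     parcs = subdiv_edges n i j p \<union> (subdiv_edges n i j p)\<inverse>\<rparr>"

lemma pair_graph_subdiv_circulant:
  assumes "0 < i" "i < n" "p \<ge> 1"
  shows "pair_graph (subdiv_circulant n i j p)"
proof
  let ?C = "carrier (residue_ring n)"
  let ?G = "subdiv_circulant n i j p"
  have n: "n > 0" using assms by simp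
  have fin: "finite ?C" by (simp add: residue_ring_def)
  have "{V a r | a r. a \<in> ?C \<and> r \<in> {1..p}} = (\<lambda>(a, r). V a r) ` (?C \<times> {1..p})" by auto
  then show fv: "finite (pverts ?G)" using fin by (simp add: subdiv_circulant_def)
  have mem: "(x + k) mod n \<in> ?C" for x k using n by (simp add: residue_ring_def)
  have pv: "subdiv_path n j p a r \<in> pverts ?G" if "a \<in> ?C" "r \<in> {0..p + 1}" for a r
    using that mem by (auto simp: subdiv_path_def subdiv_circulant_def)
  have "subdiv_edges n i j p \<subseteq> pverts ?G \<times> pverts ?G"
  proof
    fix e assume "e \<in> subdiv_edges n i j p"
    then consider a where "a \<in> ?C" "e = (U a, U ((a + i) mod n))"
      | a r where "a \<in> ?C" "r \<in> {0..p}"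
          "e = (subdiv_path n j p a r, subdiv_path n j p a (r + 1))"
      by (auto simp: subdiv_edges_def)
    then show "e \<in> pverts ?G \<times> pverts ?G"
    proof cases
      case 1 then show ?thesis using mem by (auto simp: subdiv_circulant_def)
    next
      case 2 then show ?thesis using pv[of a r] pv[of a "r + 1"] by auto
    qed
  qed
  then have sub: "parcs ?G \<subseteq> pverts ?G \<times> pverts ?G" by (auto simp: subdiv_circulant_def)
  then show "finite (parcs ?G)" using fv finite_subset by blast
  show "fst e \<in> pverts ?G" "snd e \<in> pverts ?G" if "e \<in> parcs ?G" for e using sub that by auto
  have "a \<noteq> (a + i) mod n" if "a \<in> ?C" for a
  proof
    assume "a = (a + i) mod n"
    then have "[a + i = a + 0] (mod n)" using that by (simp add: cong_def residue_ring_def)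
    then have "[i = 0] (mod n)" by (simp only: cong_add_lcancel)
    then show False using assms by (simp add: cong_0_iff zdvd_not_zless)
  qed
  moreover have "subdiv_path n j p a r \<noteq> subdiv_path n j p a (r + 1)" if "r \<in> {0..p}" for a r
    using that assms by (auto simp: subdiv_path_def)
  ultimately have "x \<noteq> y" if "(x, y) \<in> subdiv_edges n i j p" for x y
    using that by (auto simp: subdiv_edges_def)
  then show "fst e \<noteq> snd e" if "e \<in> parcs ?G" for e
    using that by (cases e) (auto simp: subdiv_circulant_def)
  have "sym (parcs ?G)" by (auto simp: subdiv_circulant_def sym_def)
  then show "symmetric ?G" by (simp add: symmetric_def)
qed

definition plus_minus :: "int \<Rightarrow> int \<Rightarrow> int set" where
  "plus_minus n k = {k mod n, (- k) mod n}"

definition mult_set :: "int \<Rightarrow> int \<Rightarrow> int set \<Rightarrow> int set" where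
  "mult_set n t A = (\<lambda>x. t \<otimes>\<^bsub>residue_ring n\<^esub> x) ` A"

definition H :: "int \<Rightarrow> int \<Rightarrow> int \<Rightarrow> int set" where
  "H n i j = {t \<in> Units (residue_ring n).
     mult_set n t (plus_minus n i \<union> plus_minus n j) = plus_minus n i \<union> plus_minus n j}"

definition H' :: "int \<Rightarrow> int \<Rightarrow> int \<Rightarrow> int set" where
  "H' n i j = {t \<in> H n i j.
     mult_set n t (plus_minus n i) = plus_minus n i \<and>
     mult_set n t (plus_minus n j) = plus_minus n j}"

definition semidirect :: "int \<Rightarrow> int \<Rightarrow> int \<Rightarrow> (int \<times> int) monoid" where
  "semidirect n i j =
    \<lparr>carrier = carrier (residue_ring n) \<times> H' n i j,
     monoid.mult = (\<lambda>(s, t) (s', t'). ((s + t * s') mod n, (t * t') mod n)),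
     one = (0, 1)\<rparr>"

lemma group_semidirect:
  assumes "n > 1"
  shows "group (semidirect n i j)"
proof -
  interpret R: residues n "residue_ring n" by unfold_locales (use assms in auto)
  let ?R = "residue_ring n"
  have mu: "x \<otimes>\<^bsub>?R\<^esub> y = x * y mod n" for x y by (simp add: residue_ring_def)
  have one: "\<one>\<^bsub>?R\<^esub> = 1" by (simp add: residue_ring_def)
  have car: "x mod n \<in> carrier ?R" for x using assms by (simp add: residue_ring_def)
  have pm: "plus_minus n k \<subseteq> carrier ?R" for k using car by (auto simp: plus_minus_def)
  have ms: "mult_set n (t \<otimes>\<^bsub>?R\<^esub> t') A = mult_set n t (mult_set n t' A)"
    if "t \<in> carrier ?R" "t' \<in> carrier ?R" "A \<subseteq> carrier ?R" for t t' A
    unfolding mult_set_def image_image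
    by (rule image_cong) (use that in \<open>auto simp: mu mod_mult_left_eq mod_mult_right_eq mult.assoc\<close>)
  have ms1: "mult_set n 1 A = A" if "A \<subseteq> carrier ?R" for A
  proof -
    have "1 \<otimes>\<^bsub>?R\<^esub> x = x" if "x \<in> carrier ?R" for x using that R.l_one one by metis
    then show ?thesis using that unfolding mult_set_def by force
  qed
  define P where "P A = {t \<in> Units ?R. mult_set n t A = A}" for A
  have P1: "1 \<in> P A" if "A \<subseteq> carrier ?R" for A
    using ms1[OF that] R.Units_one_closed one by (simp add: P_def)
  have PM: "t \<otimes>\<^bsub>?R\<^esub> t' \<in> P A" if "t \<in> P A" "t' \<in> P A" "A \<subseteq> carrier ?R" for t t' A
    using that ms[of t t' A] by (auto simp: P_def)
  have PI: "inv\<^bsub>?R\<^esub> t \<in> P A" if "t \<in> P A" "A \<subseteq> carrier ?R" for t A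
  proof -
    have t: "t \<in> Units ?R" "mult_set n t A = A" using that by (auto simp: P_def)
    have "mult_set n (inv\<^bsub>?R\<^esub> t) A = mult_set n (inv\<^bsub>?R\<^esub> t) (mult_set n t A)" using t by simp
    also have "\<dots> = mult_set n (inv\<^bsub>?R\<^esub> t \<otimes>\<^bsub>?R\<^esub> t) A"
      using ms[of "inv\<^bsub>?R\<^esub> t" t A] t that R.Units_closed[OF t(1)] by simp
    also have "\<dots> = A" using t ms1[OF that(2)] one by simp
    finally show ?thesis using t by (simp add: P_def)
  qed
  let ?i = "plus_minus n i" and ?j = "plus_minus n j"
  have H': "H' n i j = P (?i \<union> ?j) \<inter> P ?i \<inter> P ?j" by (auto simp: H'_def H_def P_def)
  have c: "?i \<union> ?j \<subseteq> carrier ?R" "?i \<subseteq> carrier ?R" "?j \<subseteq> carrier ?R" using pm by auto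
  have h1: "1 \<in> H' n i j" using P1 c by (simp add: H')
  have hm: "t * t' mod n \<in> H' n i j" if "t \<in> H' n i j" "t' \<in> H' n i j" for t t'
    using that PM c by (simp add: H' flip: mu)
  have hi: "\<exists>t'\<in>H' n i j. t' * t mod n = 1" if "t \<in> H' n i j" for t
  proof (rule bexI)
    show "inv\<^bsub>?R\<^esub> t \<in> H' n i j" using that PI c by (simp add: H')
    have "t \<in> Units ?R" using that by (simp add: H' P_def)
    then show "inv\<^bsub>?R\<^esub> t * t mod n = 1" by (simp add: one flip: mu)
  qed
  have hc: "t mod n = t" if "t \<in> H' n i j" for t
  proof -
    have "t \<in> carrier ?R" using that by (auto simp: H' P_def)
    then show ?thesis by (simp add: residue_ring_def)
  qed
  have cc: "s mod n = s" if "s \<in> carrier ?R" for s using that by (simp add: residue_ring_def)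
  show ?thesis
  proof (rule groupI)
    show "x \<otimes>\<^bsub>semidirect n i j\<^esub> y \<in> carrier (semidirect n i j)"
      if "x \<in> carrier (semidirect n i j)" "y \<in> carrier (semidirect n i j)" for x y
      using that car hm by (auto simp: semidirect_def)
    show "\<one>\<^bsub>semidirect n i j\<^esub> \<in> carrier (semidirect n i j)"
      using h1 assms by (simp add: semidirect_def residue_ring_def)
    show "(x \<otimes>\<^bsub>semidirect n i j\<^esub> y) \<otimes>\<^bsub>semidirect n i j\<^esub> z =
          x \<otimes>\<^bsub>semidirect n i j\<^esub> (y \<otimes>\<^bsub>semidirect n i j\<^esub> z)" for x y z
    proof -
      obtain s t s' t' s'' t'' where e: "x = (s, t)" "y = (s', t')" "z = (s'', t'')"
        by (cases x, cases y, cases z) auto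
      have "[(s + t * s') mod n + (t * t') mod n * s'' = s + t * s' + t * t' * s''] (mod n)"
        by (intro cong_add cong_mult) (simp_all add: cong_def)
      moreover have "[s + t * ((s' + t' * s'') mod n) = s + t * (s' + t' * s'')] (mod n)"
        by (intro cong_add cong_mult) (simp_all add: cong_def)
      ultimately show ?thesis
        by (simp add: semidirect_def e cong_def algebra_simps mod_mult_left_eq mod_mult_right_eq)
    qed
    show "\<one>\<^bsub>semidirect n i j\<^esub> \<otimes>\<^bsub>semidirect n i j\<^esub> x = x"
      if "x \<in> carrier (semidirect n i j)" for x
      using that hc cc by (auto simp: semidirect_def)
    show "\<exists>y\<in>carrier (semidirect n i j). y \<otimes>\<^bsub>semidirect n i j\<^esub> x = \<one>\<^bsub>semidirect n i j\<^esub>"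
      if xc: "x \<in> carrier (semidirect n i j)" for x
    proof -
      obtain s t where x: "x = (s, t)" "t \<in> H' n i j" using xc by (cases x) (auto simp: semidirect_def)
      obtain t' where t': "t' \<in> H' n i j" "t' * t mod n = 1" using hi x by blast
      have "((- (t' * s)) mod n + t' * s) mod n = 0" by (simp add: mod_add_left_eq)
      then show ?thesis using x t' car
        by (intro bexI[of _ "((- (t' * s)) mod n, t')"]) (auto simp: semidirect_def)
    qed
  qed
qed

definition circulant_action :: "int \<Rightarrow> int \<times> int \<Rightarrow> int \<Rightarrow> int" where
  "circulant_action n = (\<lambda>(s, t). \<lambda>a\<in>carrier (residue_ring n). (s + t * a) mod n)"

text \<open>
  The last case below is \<open>t * j \<equiv> - j\<close>: for \<open>t \<in> H' n i j\<close> one of the two congruences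
  holds, and not both if \<open>0 < j < n / 2\<close>.
\<close>

definition subdiv_action ::
    "int \<Rightarrow> int \<Rightarrow> int \<Rightarrow> int \<Rightarrow> int \<times> int \<Rightarrow> subdiv_vertex \<Rightarrow> subdiv_vertex" where
  "subdiv_action n i j p = (\<lambda>(s, t). \<lambda>x\<in>pverts (subdiv_circulant n i j p).
     case x of
       U a \<Rightarrow> U ((s + t * a) mod n)
     | V a r \<Rightarrow> (if [t * j = j] (mod n) then V ((s + t * a) mod n) r
                else V ((s + t * a - j) mod n) ((p + 1) - r)))"

definition extends_on_U :: "int \<Rightarrow> (subdiv_vertex \<Rightarrow> subdiv_vertex) \<Rightarrow> (int \<Rightarrow> int) \<Rightarrow> bool" where
  "extends_on_U n \<alpha> \<alpha>' \<longleftrightarrow> (\<forall>a\<in>carrier (residue_ring n). \<alpha> (U a) = U (\<alpha>' a))"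

end

theory Submission
  imports Defs
begin

text \<open>
  Let \<open>\<alpha>\<close> be an automorphism of the subdivided graph. Each \<open>u\<^sub>a\<close> has more than two neighbours
  and each \<open>v\<^sub>a\<^sup>r\<close> has two, so \<open>\<alpha>\<close> permutes the \<open>u\<^sub>a\<close>. Hence it maps edges between the
  \<open>u\<^sub>a\<close> to such edges, and subdivided paths to subdivided paths, possibly backwards. The map \<open>f\<close>
  that \<open>\<alpha>\<close> induces on \<open>\<int>\<^sub>n\<close> thus changes by \<open>\<plusminus>i\<close> when its argument grows by \<open>i\<close>, and by
  \<open>\<plusminus>j\<close> when its argument grows by \<open>j\<close>.

  Such a map is affine, which is the heart of the proof (\<open>sign_step_map_affine\<close>). Since \<open>f\<close> is
  injective and \<open>2 * i \<not>\<equiv> 0\<close>, the sign of the \<open>i\<close>-steps is constant along \<open>a, a + i, a + 2 * i, ...\<close>;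
  likewise for \<open>j\<close>. Going round the square \<open>a, a + i, a + i + j, a + j\<close> shows that a change of the sign
  of the \<open>i\<close>-step between \<open>a\<close> and \<open>a + j\<close> would make \<open>2 * i\<close> congruent to \<open>0\<close> or \<open>\<plusminus>2 * j\<close>. As
  \<open>0 < i < j < n / 2\<close>, this leaves only \<open>2 * (i + j) = n\<close>. But then \<open>i\<close> or \<open>j\<close> is a unit
  (\<open>unit_if_half_sum\<close>), so that \<open>i = 1\<close> by hypothesis, and the \<open>i\<close>-steps alone already reach all of \<open>\<int>\<^sub>n\<close>.
  So all signs are constant. By connectedness \<open>i\<close> and \<open>j\<close> generate \<open>\<int>\<^sub>n\<close>, whence
  \<open>f a \<equiv> s + t * a\<close> with \<open>t * i \<equiv> \<plusminus>i\<close> and \<open>t * j \<equiv> \<plusminus>j\<close>, that is, with \<open>t\<close> in \<open>H'\<close>.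

  Whether \<open>\<alpha>\<close> reverses the subdivided paths is read off from the sign in \<open>t * j \<equiv> \<plusminus>j\<close>, since
  \<open>j \<not>\<equiv> - j\<close>; so \<open>\<alpha>\<close> is the action of \<open>(s, t)\<close> (\<open>aut_eq_action\<close>). Conversely, every \<open>(s, t)\<close>
  acts by an automorphism, and composition of the actions is the product of the semidirect product
  (\<open>subdiv_action_hom\<close>). The images of \<open>u\<^sub>0\<close> and \<open>u\<^sub>1\<close> determine \<open>(s, t)\<close>, which gives both
  injectivity and the uniqueness of extensions.
\<close>

section \<open>Integer maps with steps of constant size\<close>

lemma cong_shift_multiple:
  fixes f :: "int \<Rightarrow> int"
  assumes "\<And>a. [f (a + k) = f a + c] (mod m)"
  shows "[f (a + x * k) = f a + x * c] (mod m)"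
proof (induction x rule: int_induct[where k = 0])
  case base
  then show ?case by simp
next
  case (step1 x)
  have "[f (a + x * k + k) = f (a + x * k) + c] (mod m)" by (rule assms)
  also have "[f (a + x * k) + c = f a + x * c + c] (mod m)" using step1 by (intro cong_add) auto
  finally show ?case by (simp add: algebra_simps)
next
  case (step2 x)
  have "[f (a + (x - 1) * k) + c = f (a + (x - 1) * k + k)] (mod m)"
    using assms cong_sym by blast
  also have "a + (x - 1) * k + k = a + x * k" by (simp add: algebra_simps)
  also have "[f (a + x * k) = f a + (x - 1) * c + c] (mod m)"
    using step2 by (simp add: algebra_simps)
  finally show ?case using cong_add_rcancel by blast
qed

lemma int_gcd_combination_1:
  fixes n i j :: int
  assumes "gcd n (gcd i j) = 1"
  obtains x y z where "1 = x * i + y * j + z * n"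
proof -
  obtain u v where "u * n + v * gcd i j = 1" using bezout_int[of n "gcd i j"] assms by auto
  moreover obtain x y where "x * i + y * j = gcd i j" using bezout_int[of i j] by auto
  ultimately have "1 = (v * x) * i + (v * y) * j + u * n" by (metis add.commute distrib_left mult.assoc)
  then show ?thesis using that by blast
qed

text \<open>The periods of \<open>g\<close> form a subgroup of \<open>\<int>\<close>, so \<open>1\<close> is a period.\<close>

lemma constant_if_generating_periods:
  fixes g :: "int \<Rightarrow> int"
  assumes "\<And>a. g (a + i) = g a" "\<And>a. g (a + j) = g a" "\<And>a. g (a + n) = g a"
    and "gcd n (gcd i j) = 1"
  shows "g a = g b"
proof -
  have mult: "g (a + x * k) = g a" if "\<And>a. g (a + k) = g a" for a x k
    using cong_shift_multiple[of g k 0 0] that by simp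
  obtain x y z where "1 = x * i + y * j + z * n" using int_gcd_combination_1[OF assms(4)] .
  then have "b = a + ((b - a) * x) * i + ((b - a) * y) * j + ((b - a) * z) * n"
    by (simp only: add.assoc mult.assoc flip: distrib_left) simp
  then have "g b = g (a + ((b - a) * x) * i + ((b - a) * y) * j + ((b - a) * z) * n)" by (rule arg_cong)
  then show ?thesis by (simp only: mult[OF assms(1)] mult[OF assms(2)] mult[OF assms(3)])
qed

lemma sign_unique:
  fixes x y k n :: int
  assumes "x = 1 \<or> x = - 1" "y = 1 \<or> y = - 1" "[x * k = y * k] (mod n)" "\<not> n dvd 2 * k"
  shows "x = y"
  using assms dvd_minus_iff[of n "2 * k"] by (auto simp: cong_iff_dvd_diff)

text \<open>A change of sign would take \<open>f\<close> back to its value two steps before.\<close>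

lemma sign_constant_along_step:
  fixes f e :: "int \<Rightarrow> int"
  assumes sgn: "\<And>a. e a = 1 \<or> e a = - 1"
    and step: "\<And>a. [f (a + k) = f a + e a * k] (mod n)"
    and inj: "\<And>a b. [f a = f b] (mod n) \<longleftrightarrow> [a = b] (mod n)"
    and "\<not> n dvd 2 * k"
  shows "e (a + k) = e a"
proof (rule ccontr)
  assume "e (a + k) \<noteq> e a"
  then have opp: "e (a + k) = - e a" using sgn[of a] sgn[of "a + k"] by auto
  have "[f (a + k + k) = f (a + k) + e (a + k) * k] (mod n)" by (rule step)
  also have "[f (a + k) + e (a + k) * k = f a + e a * k + e (a + k) * k] (mod n)"
    by (intro cong_add step) simp
  finally have "[f (a + k + k) = f a] (mod n)" by (simp add: opp)
  then show False using inj assms(4) by (simp add: cong_iff_dvd_diff)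
qed

locale circulant_params =
  fixes n i j :: int
  assumes i_pos: "0 < i" and i_less_j: "i < j" and two_j_less: "2 * j < n"
    and gcd_1: "gcd n (gcd i j) = 1"
begin

lemma n_pos: "0 < n" and n_gt_1: "1 < n"
  using i_pos i_less_j two_j_less by auto

lemma not_dvd: "\<not> n dvd j" "\<not> n dvd 2 * i" "\<not> n dvd 2 * j"
  using i_pos i_less_j two_j_less zdvd_not_zless by auto

lemma j_not_cong_minus_j: "\<not> [j = - j] (mod n)"
  using not_dvd by (auto simp: cong_iff_dvd_diff)

text \<open>
  A common divisor of \<open>i\<close> and \<open>j\<close> divides \<open>n = 2 * (i + j)\<close>, so \<open>i\<close> and \<open>j\<close> are coprime and one of
  them is odd. The odd one is coprime both to \<open>2\<close> and to \<open>i + j\<close>.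
\<close>

lemma unit_if_half_sum:
  assumes "2 * (i + j) = n"
  shows "coprime i n \<or> coprime j n"
proof -
  have "gcd i j dvd n" using assms by (metis dvd_add dvd_mult gcd_dvd1 gcd_dvd2)
  then have cop: "coprime i j" using gcd_1 by (simp add: coprime_iff_gcd_eq_1 gcd.commute gcd_proj2_if_dvd_int)
  then have "coprime i 2 \<or> coprime j 2"
    by (metis coprime_common_divisor coprime_right_2_iff_odd odd_one)
  moreover have "coprime i (i + j)" "coprime j (i + j)"
    using cop by (simp_all add: coprime_iff_gcd_eq_1 gcd.commute[of j])
  ultimately show ?thesis using assms by (metis coprime_mult_right_iff)
qed

text \<open>
  Let \<open>e a\<close> and \<open>d a\<close> be the signs of the steps by \<open>i\<close> and by \<open>j\<close> that start at \<open>a\<close>. The proof shows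
  that both have the periods \<open>i\<close>, \<open>j\<close> and \<open>n\<close>, hence are constant. Then \<open>f\<close> has constant increments
  along \<open>i\<close> and \<open>j\<close>, and so also along \<open>1\<close>, an integral combination of \<open>i\<close>, \<open>j\<close> and \<open>n\<close>.
\<close>

lemma sign_step_map_affine:
  fixes f :: "int \<Rightarrow> int"
  assumes units: "i = 1 \<or> \<not> coprime i n \<and> \<not> coprime j n"
    and inj: "\<And>a b. [f a = f b] (mod n) \<longleftrightarrow> [a = b] (mod n)"
    and step_i: "\<And>a. [f (a + i) = f a + i] (mod n) \<or> [f (a + i) = f a - i] (mod n)"
    and step_j: "\<And>a. [f (a + j) = f a + j] (mod n) \<or> [f (a + j) = f a - j] (mod n)"
  obtains t where "\<And>a. [f a = f 0 + t * a] (mod n)"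
    and "[t * i = i] (mod n) \<or> [t * i = - i] (mod n)"
    and "[t * j = j] (mod n) \<or> [t * j = - j] (mod n)"
proof -
  have "\<exists>x. (x = 1 \<or> x = - 1) \<and> [f (a + i) = f a + x * i] (mod n)" for a
    using step_i[of a] by (metis mult_1 mult_minus_left uminus_add_conv_diff add.commute)
  then obtain e where e: "\<And>a. e a = 1 \<or> e a = - 1" "\<And>a. [f (a + i) = f a + e a * i] (mod n)"
    by metis
  have "\<exists>x. (x = 1 \<or> x = - 1) \<and> [f (a + j) = f a + x * j] (mod n)" for a
    using step_j[of a] by (metis mult_1 mult_minus_left uminus_add_conv_diff add.commute)
  then obtain d where d: "\<And>a. d a = 1 \<or> d a = - 1" "\<And>a. [f (a + j) = f a + d a * j] (mod n)"
    by metis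
  have e_i: "e (a + i) = e a" for a
    by (rule sign_constant_along_step[OF e inj]) (use not_dvd in simp)
  have d_j: "d (a + j) = d a" for a
    by (rule sign_constant_along_step[OF d inj]) (use not_dvd in simp)
  have f_n: "[f (a + n) = f a] (mod n)" for a
    using inj[of "a + n" a] by (simp add: cong_def)
  have sign_n: "x (a + n) = x a"
    if x: "\<And>a. x a = 1 \<or> x a = - 1" "\<And>a. [f (a + k) = f a + x a * k] (mod n)" "\<not> n dvd 2 * k"
    for x k a
  proof (rule sign_unique)
    have "[f (a + n) + x (a + n) * k = f (a + n + k)] (mod n)" using x(2) cong_sym by blast
    also have "[f (a + n + k) = f (a + k)] (mod n)"
      using f_n[of "a + k"] by (simp add: add.commute add.left_commute)
    also have "[f (a + k) = f a + x a * k] (mod n)" by (rule x(2))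
    also have "[f a + x a * k = f (a + n) + x a * k] (mod n)"
      using f_n[of a] by (intro cong_add) (auto simp: cong_sym)
    finally show "[x (a + n) * k = x a * k] (mod n)" using cong_add_lcancel by blast
  qed (use x in auto)
  have e_n: "e (a + n) = e a" and d_n: "d (a + n) = d a" for a
    using sign_n e d not_dvd by blast+
  \<comment> \<open>The two ways from \<open>a\<close> to \<open>a + i + j\<close> round a square.\<close>
  have square: "[e a * i + d (a + i) * j = d a * j + e (a + j) * i] (mod n)" for a
  proof -
    have "[f a + e a * i + d (a + i) * j = f (a + i) + d (a + i) * j] (mod n)"
      using e(2)[of a] by (intro cong_add) (auto simp: cong_sym)
    also have "[f (a + i) + d (a + i) * j = f (a + i + j)] (mod n)" using d(2) cong_sym by blast
    also have "f (a + i + j) = f (a + j + i)" by (simp add: algebra_simps)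
    also have "[f (a + j + i) = f (a + j) + e (a + j) * i] (mod n)" by (rule e(2))
    also have "[f (a + j) + e (a + j) * i = f a + d a * j + e (a + j) * i] (mod n)"
      using d(2)[of a] by (intro cong_add) auto
    finally show ?thesis by (simp only: add.assoc cong_add_lcancel)
  qed
  have e_j: "e (a + j) = e a" for a
  proof (cases "i = 1")
    case True
    then show ?thesis using constant_if_generating_periods[of e i i n] e_i e_n by simp
  next
    case False
    show ?thesis
    proof (rule ccontr)
      assume "e (a + j) \<noteq> e a"
      then have "e (a + j) = - e a" using e(1)[of a] e(1)[of "a + j"] by auto
      then have *: "n dvd 2 * (e a * i) + (d (a + i) - d a) * j"
        using square[of a] by (simp add: cong_iff_dvd_diff algebra_simps)
      \<comment> \<open>Multiplying by the sign \<open>e a\<close> leaves only three cases.\<close>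
      define c where "c = e a * (d (a + i) - d a)"
      have "2 * i + c * j = e a * (2 * (e a * i) + (d (a + i) - d a) * j)"
        using e(1)[of a] by (auto simp: c_def algebra_simps)
      then have "n dvd 2 * i + c * j" using dvd_mult[OF *] by simp
      moreover have "c = 0 \<or> c = 2 \<or> c = - 2"
        using e(1)[of a] d(1)[of a] d(1)[of "a + i"] by (auto simp: c_def)
      ultimately have "n dvd 2 * i \<or> n dvd 2 * i + 2 * j \<or> n dvd 2 * i - 2 * j" by auto
      moreover have "\<not> n dvd 2 * j - 2 * i"
        by (rule zdvd_not_zless) (use i_pos i_less_j two_j_less in auto)
      ultimately have "n dvd 2 * i + 2 * j" using not_dvd dvd_diff_commute by blast
      then obtain m where m: "2 * i + 2 * j = n * m" by (elim dvdE)
      have "0 < n * m" "n * m < n * 2"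
        unfolding m[symmetric] using i_pos i_less_j two_j_less by linarith+
      then have "0 < m" "m < 2"
        using n_pos zero_less_mult_pos mult_less_cancel_left_pos by blast+
      then have "m = 1" by simp
      then have "2 * (i + j) = n" using m by simp
      then show False using unit_if_half_sum units False by blast
    qed
  qed
  \<comment> \<open>The two \<open>i\<close>-steps of the square now cancel.\<close>
  have d_i: "d (a + i) = d a" for a
  proof (rule sign_unique)
    have "[e a * i + d (a + i) * j = e a * i + d a * j] (mod n)"
      using square[of a] e_j[of a] by (simp add: add.commute[of "d a * j"])
    then show "[d (a + i) * j = d a * j] (mod n)" by (simp only: cong_add_lcancel)
  qed (use d not_dvd in auto)
  define \<epsilon> \<delta> where "\<epsilon> = e 0" and "\<delta> = d 0"
  have const: "e a = \<epsilon>" "d a = \<delta>" for a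
    unfolding \<epsilon>_def \<delta>_def
    by (rule constant_if_generating_periods[OF e_i e_j e_n gcd_1])
      (rule constant_if_generating_periods[OF d_i d_j d_n gcd_1])
  have f_i: "[f (a + x * i) = f a + x * (\<epsilon> * i)] (mod n)" for a x
    by (rule cong_shift_multiple) (use e(2) const in simp)
  have f_j: "[f (a + y * j) = f a + y * (\<delta> * j)] (mod n)" for a y
    by (rule cong_shift_multiple) (use d(2) const in simp)
  have f_nz: "[f (a + z * n) = f a + z * 0] (mod n)" for a z
    by (rule cong_shift_multiple) (use f_n in simp)
  obtain x y z where xyz: "1 = x * i + y * j + z * n" using int_gcd_combination_1[OF gcd_1] .
  define t where "t = x * (\<epsilon> * i) + y * (\<delta> * j)"
  have "[f (a + 1) = f a + t] (mod n)" for a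
  proof -
    have "[f (a + x * i + y * j + z * n) = f (a + x * i + y * j)] (mod n)" using f_nz by simp
    also have "[f (a + x * i + y * j) = f (a + x * i) + y * (\<delta> * j)] (mod n)" by (rule f_j)
    also have "[f (a + x * i) + y * (\<delta> * j) = f a + x * (\<epsilon> * i) + y * (\<delta> * j)] (mod n)"
      by (intro cong_add f_i) simp
    finally show ?thesis using xyz by (simp add: t_def add.assoc)
  qed
  then have aff: "[f (a + b * 1) = f a + b * t] (mod n)" for a b by (rule cong_shift_multiple)
  have t_step: "[t * k = c * k] (mod n)" if "[f (0 + 1 * k) = f 0 + 1 * (c * k)] (mod n)" for k c
  proof -
    have "[f 0 + k * t = f (0 + k * 1)] (mod n)" using aff cong_sym by blast
    also have "[f (0 + k * 1) = f 0 + c * k] (mod n)" using that by simp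
    finally show ?thesis by (simp only: cong_add_lcancel mult.commute[of t])
  qed
  show ?thesis
  proof
    show "[f a = f 0 + t * a] (mod n)" for a using aff[of 0 a] by (simp add: mult.commute)
    show "[t * i = i] (mod n) \<or> [t * i = - i] (mod n)"
      using t_step[OF f_i] e(1)[of 0] by (auto simp: \<epsilon>_def)
    show "[t * j = j] (mod n) \<or> [t * j = - j] (mod n)"
      using t_step[OF f_j] d(1)[of 0] by (auto simp: \<delta>_def)
  qed
qed

end

lemma mod_add_cong_right:
  fixes x y z n :: int
  shows "[y = z] (mod n) \<Longrightarrow> (x + y) mod n = (x + z) mod n"
  unfolding cong_def by (metis mod_add_right_eq)

lemma affine_compose_mod:
  fixes s t s' t' a n :: int
  shows "((s + t * s') mod n + t * t' mod n * a) mod n = (s + t * ((s' + t' * a) mod n)) mod n"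
proof -
  have "[(s + t * s') mod n + t * t' mod n * a = s + t * s' + t * t' * a] (mod n)"
    by (intro cong_add cong_mult) (simp_all add: cong_def)
  moreover have "[s + t * ((s' + t' * a) mod n) = s + t * (s' + t' * a)] (mod n)"
    by (intro cong_add cong_mult) (simp_all add: cong_def)
  ultimately show ?thesis by (simp add: cong_def algebra_simps)
qed

lemma cong_dvd_difference:
  fixes a b g m :: int
  assumes "[a - b = k] (mod m)" "g dvd m" "g dvd k"
  shows "g dvd a - b"
proof -
  have "g dvd a - b - k" using assms(1,2) dvd_trans by (auto simp: cong_iff_dvd_diff)
  then have "g dvd a - b - k + k" using assms(3) by (rule dvd_add)
  then show ?thesis by simp
qed

text \<open>Adjacent vertices are congruent modulo the greatest common divisor, so \<open>0\<close> and \<open>1\<close> are.\<close>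

lemma gcd_1_if_circulant_connected:
  fixes n i j :: int
  assumes con: "connected (circulant n i j)" and n: "1 < n"
  shows "gcd n (gcd i j) = 1"
proof -
  let ?S = "mk_symmetric (circulant n i j)" and ?g = "gcd n (gcd i j)"
  have arc: "?g dvd a - b" if "(a, b) \<in> parcs (circulant n i j)" for a b
  proof -
    have "?g dvd n" "?g dvd i" "?g dvd j" by (auto intro: dvd_trans[OF gcd_dvd2])
    then show ?thesis
      using that cong_dvd_difference[of a b _ n ?g] by (auto simp: circulant_def simp del: gcd_dvd1)
  qed
  have "?g dvd a" if "0 \<rightarrow>\<^sup>*\<^bsub>?S\<^esub> a" for a
    using that unfolding reachable_def
  proof (induction rule: rtrancl_on_induct)
    case base
    then show ?case by simp
  next
    case (step x y)
    then have "(x, y) \<in> parcs (circulant n i j) \<or> (y, x) \<in> parcs (circulant n i j)"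
      by (auto simp: parcs_mk_symmetric)
    then have "?g dvd x - y" using arc[of x y] arc[of y x] dvd_diff_commute by blast
    then show ?case using step.IH dvd_diff[of ?g x "x - y"] by simp
  qed
  moreover have "0 \<rightarrow>\<^sup>*\<^bsub>?S\<^esub> 1"
    using con n by (auto simp: connected_def strongly_connected_def circulant_def residue_ring_def)
  ultimately have "?g dvd 1" by blast
  then show ?thesis using gcd_ge_0_int[of n "gcd i j"] by (simp only: zdvd1_eq abs_of_nonneg)
qed

section \<open>The group \<open>H'\<close>\<close>

lemma plus_minus_eq_iff:
  "plus_minus n k = plus_minus n l \<longleftrightarrow> [k = l] (mod n) \<or> [k = - l] (mod n)"
proof -
  have neg: "(- k) mod n = (- l) mod n \<longleftrightarrow> k mod n = l mod n"
    and swap: "(- k) mod n = l mod n \<longleftrightarrow> k mod n = (- l) mod n"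
    using cong_minus_minus_iff[of k l n] cong_minus_minus_iff[of k "- l" n] by (auto simp: cong_def)
  show ?thesis unfolding plus_minus_def cong_def doubleton_eq_iff neg swap by auto
qed

lemma mult_set_plus_minus: "mult_set n t (plus_minus n k) = plus_minus n (t * k)"
  by (simp add: mult_set_def plus_minus_def residue_ring_def mod_mult_right_eq)

context circulant_params
begin

abbreviation C :: "int set" where "C \<equiv> carrier (residue_ring n)"

lemma mem_C: "a \<in> C \<longleftrightarrow> 0 \<le> a \<and> a < n"
  by (auto simp: residue_ring_def)

lemma mod_mem_C [simp]: "a mod n \<in> C"
  using n_pos by (simp add: mem_C)

lemma mod_C [simp]: "a \<in> C \<Longrightarrow> a mod n = a"
  by (simp add: mem_C)

lemma cong_C_eq: "a \<in> C \<Longrightarrow> b \<in> C \<Longrightarrow> [a = b] (mod n) \<Longrightarrow> a = b"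
  by (metis cong_def mod_C)

lemma Units_eq: "Units (residue_ring n) = {t \<in> C. coprime t n}"
proof -
  interpret R: residues n "residue_ring n" by unfold_locales (use n_gt_1 in auto)
  have "t \<noteq> 0" if "coprime t n" for t using that n_gt_1 by auto
  then show ?thesis unfolding R.res_units_eq using mem_C order_le_less by auto
qed

text \<open>
  Multiplication by \<open>t * t\<close> fixes \<open>i\<close> and \<open>j\<close>, and these generate \<open>\<int>\<^sub>n\<close>; so every element of
  \<open>H'\<close> is its own inverse.
\<close>

lemma square_cong_1:
  assumes "[t * i = i] (mod n) \<or> [t * i = - i] (mod n)"
    and "[t * j = j] (mod n) \<or> [t * j = - j] (mod n)"
  shows "[t * t = 1] (mod n)"
proof -
  have sq: "n dvd (t * t - 1) * k" if "[t * k = k] (mod n) \<or> [t * k = - k] (mod n)" for k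
  proof -
    have "[t * (t * k) = k] (mod n)" using that
    proof
      assume h: "[t * k = k] (mod n)"
      then have "[t * (t * k) = t * k] (mod n)" by (rule cong_scalar_left)
      then show ?thesis using h by (rule cong_trans)
    next
      assume h: "[t * k = - k] (mod n)"
      then have "[t * (t * k) = t * (- k)] (mod n)" by (rule cong_scalar_left)
      also have "[t * (- k) = - (- k)] (mod n)"
        using h by (metis cong_minus_minus_iff mult_minus_right)
      finally show ?thesis by simp
    qed
    then show ?thesis by (simp add: cong_iff_dvd_diff algebra_simps)
  qed
  obtain x y z where "1 = x * i + y * j + z * n" using int_gcd_combination_1[OF gcd_1] .
  then have "t * t - 1 = (t * t - 1) * (x * i + y * j + z * n)" by simp
  also have "\<dots> = x * ((t * t - 1) * i) + y * ((t * t - 1) * j) + z * (t * t - 1) * n"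
    by (simp add: algebra_simps)
  also have "n dvd \<dots>"
    using dvd_mult[OF sq[OF assms(1)], of x] dvd_mult[OF sq[OF assms(2)], of y]
    by (intro dvd_add dvd_triv_right)
  finally show ?thesis by (simp add: cong_iff_dvd_diff)
qed

text \<open>Membership in \<open>H'\<close> as two congruences; that \<open>t\<close> is a unit follows from \<open>t * t \<equiv> 1\<close>.\<close>

lemma mem_H'_iff:
  "t \<in> H' n i j \<longleftrightarrow> t \<in> C \<and> ([t * i = i] (mod n) \<or> [t * i = - i] (mod n)) \<and>
     ([t * j = j] (mod n) \<or> [t * j = - j] (mod n))"
    (is "_ \<longleftrightarrow> ?R")
proof -
  have cop: "coprime t n" if ?R
  proof -
    have "[t * t = 1] (mod n)" using that square_cong_1 by blast
    then show ?thesis using coprime_iff_invertible_int by blast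
  qed
  have "mult_set n t (plus_minus n i \<union> plus_minus n j) =
      mult_set n t (plus_minus n i) \<union> mult_set n t (plus_minus n j)"
    by (simp add: mult_set_def image_Un)
  then have "t \<in> H' n i j \<longleftrightarrow> t \<in> C \<and> coprime t n \<and>
      mult_set n t (plus_minus n i) = plus_minus n i \<and> mult_set n t (plus_minus n j) = plus_minus n j"
    unfolding H'_def H_def Units_eq by auto
  then show ?thesis using cop unfolding mult_set_plus_minus plus_minus_eq_iff by blast
qed

lemma mem_semidirect_iff: "(s, t) \<in> carrier (semidirect n i j) \<longleftrightarrow> s \<in> C \<and> t \<in> H' n i j"
  by (simp add: semidirect_def)

end

section \<open>Actions by graph automorphisms\<close>

text \<open>
  For a group action it suffices that every element maps arcs to arcs: applied to the inverse
  element, this shows that non-arcs are mapped to non-arcs, and bijectivity comes the same way.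
\<close>

lemma hom_aut_groupI:
  assumes "group K"
    and ext: "\<And>x. x \<in> carrier K \<Longrightarrow> \<phi> x \<in> extensional (pverts G)"
    and closed: "\<And>x v. x \<in> carrier K \<Longrightarrow> v \<in> pverts G \<Longrightarrow> \<phi> x v \<in> pverts G"
    and mult: "\<And>x y v. x \<in> carrier K \<Longrightarrow> y \<in> carrier K \<Longrightarrow> v \<in> pverts G \<Longrightarrow>
      \<phi> (x \<otimes>\<^bsub>K\<^esub> y) v = \<phi> x (\<phi> y v)"
    and one: "\<And>v. v \<in> pverts G \<Longrightarrow> \<phi> \<one>\<^bsub>K\<^esub> v = v"
    and arcs: "\<And>x v w. x \<in> carrier K \<Longrightarrow> (v, w) \<in> parcs G \<Longrightarrow> (\<phi> x v, \<phi> x w) \<in> parcs G"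
  shows "\<phi> \<in> hom K (aut_group G)"
proof -
  interpret K: group K by fact
  have inv: "\<phi> (inv\<^bsub>K\<^esub> x) (\<phi> x v) = v" "\<phi> x (\<phi> (inv\<^bsub>K\<^esub> x) v) = v"
    if "x \<in> carrier K" "v \<in> pverts G" for x v
    using that mult[of "inv\<^bsub>K\<^esub> x" x v] mult[of x "inv\<^bsub>K\<^esub> x" v] one by simp_all
  have aut: "\<phi> x \<in> carrier (aut_group G)" if x: "x \<in> carrier K" for x
  proof -
    have "bij_betw (\<phi> x) (pverts G) (pverts G)"
      by (rule bij_betw_byWitness[where f' = "\<phi> (inv\<^bsub>K\<^esub> x)"]) (use x inv closed in auto)
    moreover have "(\<phi> x v, \<phi> x w) \<in> parcs G \<longleftrightarrow> (v, w) \<in> parcs G"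
      if "v \<in> pverts G" "w \<in> pverts G" for v w
      using arcs[OF x, of v w] arcs[of "inv\<^bsub>K\<^esub> x" "\<phi> x v" "\<phi> x w"] inv x that by auto
    ultimately show ?thesis using ext[OF x] by (auto simp: aut_group_def Bij_def)
  qed
  show ?thesis
  proof (rule homI)
    fix x y assume xy: "x \<in> carrier K" "y \<in> carrier K"
    then have Bij: "\<phi> x \<in> Bij (pverts G)" "\<phi> y \<in> Bij (pverts G)"
      using aut by (auto simp: aut_group_def)
    have "\<phi> (x \<otimes>\<^bsub>K\<^esub> y) = compose (pverts G) (\<phi> x) (\<phi> y)"
      by (rule extensionalityI[OF ext]) (use xy mult in \<open>auto simp: compose_def\<close>)
    then show "\<phi> (x \<otimes>\<^bsub>K\<^esub> y) = \<phi> x \<otimes>\<^bsub>aut_group G\<^esub> \<phi> y"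
      using Bij by (simp add: aut_group_def BijGroup_def)
  qed (use aut in simp)
qed

context circulant_params
begin

lemma circulant_action_hom:
  "circulant_action n \<in> hom (semidirect n i j) (aut_group (circulant n i j))"
proof (rule hom_aut_groupI)
  show "group (semidirect n i j)" using group_semidirect n_gt_1 .
  have V: "pverts (circulant n i j) = C" by (simp add: circulant_def)
  show "circulant_action n x \<in> extensional (pverts (circulant n i j))" for x
    by (cases x) (simp add: circulant_action_def V)
  show "circulant_action n x v \<in> pverts (circulant n i j)" if "v \<in> pverts (circulant n i j)" for x v
    using that by (cases x) (simp add: circulant_action_def V)
  show "circulant_action n (x \<otimes>\<^bsub>semidirect n i j\<^esub> y) v = circulant_action n x (circulant_action n y v)"
    if "v \<in> pverts (circulant n i j)" for x y v
    using that
    by (cases x; cases y) (simp add: circulant_action_def V semidirect_def affine_compose_mod)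
  show "circulant_action n \<one>\<^bsub>semidirect n i j\<^esub> v = v" if "v \<in> pverts (circulant n i j)" for v
    using that by (simp add: circulant_action_def V semidirect_def)
  show "(circulant_action n x v, circulant_action n x w) \<in> parcs (circulant n i j)"
    if x: "x \<in> carrier (semidirect n i j)" and vw: "(v, w) \<in> parcs (circulant n i j)" for x v w
  proof -
    obtain s t where st: "x = (s, t)" "t \<in> H' n i j"
      using x by (cases x) (simp add: mem_semidirect_iff)
    have vC: "v \<in> C" "w \<in> C" using vw by (auto simp: circulant_def)
    have diff: "[(s + t * v) mod n - (s + t * w) mod n = t * (v - w)] (mod n)"
      by (simp add: cong_def mod_simps algebra_simps)
    have sgn: "[t * (v - w) = k] (mod n) \<or> [t * (v - w) = - k] (mod n)"
      if k: "[t * k = k] (mod n) \<or> [t * k = - k] (mod n)"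
        and d: "[v - w = k] (mod n) \<or> [v - w = - k] (mod n)" for k
    proof -
      have "[t * (v - w) = t * k] (mod n) \<or> [t * (v - w) = - (t * k)] (mod n)"
        using d cong_scalar_left[of "v - w" _ n t] by fastforce
      moreover have "[- (t * k) = - k] (mod n) \<or> [- (t * k) = k] (mod n)"
        using k cong_minus_minus_iff[of "t * k" k n] cong_minus_minus_iff[of "t * k" "- k" n] by auto
      ultimately show ?thesis using k cong_trans by blast
    qed
    have "[v - w = i] (mod n) \<or> [v - w = - i] (mod n) \<or> [v - w = j] (mod n) \<or> [v - w = - j] (mod n)"
      using vw by (auto simp: circulant_def)
    then have "[t * (v - w) = i] (mod n) \<or> [t * (v - w) = - i] (mod n) \<or>
        [t * (v - w) = j] (mod n) \<or> [t * (v - w) = - j] (mod n)"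
      using st(2) sgn[of i] sgn[of j] unfolding mem_H'_iff by blast
    then show ?thesis
      using vC cong_trans[OF diff] by (auto simp: circulant_def circulant_action_def st(1))
  qed
qed

end

section \<open>The subdivided graph\<close>

locale subdiv_params = circulant_params +
  fixes p :: int
  assumes p_pos: "1 \<le> p"
begin

abbreviation \<Gamma> :: "subdiv_vertex pair_pre_digraph" where "\<Gamma> \<equiv> subdiv_circulant n i j p"

abbreviation path :: "int \<Rightarrow> int \<Rightarrow> subdiv_vertex" where "path \<equiv> subdiv_path n j p"

lemma path_ends [simp]: "path a 0 = U a" "path a (p + 1) = U ((a + j) mod n)"
  using p_pos by (auto simp: subdiv_path_def)

lemma path_inner: "1 \<le> r \<Longrightarrow> r \<le> p \<Longrightarrow> path a r = V a r"
  by (simp add: subdiv_path_def)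

lemma U_in_verts [simp]: "U a \<in> pverts \<Gamma> \<longleftrightarrow> a \<in> C"
  by (auto simp: subdiv_circulant_def)

lemma V_in_verts [simp]: "V a r \<in> pverts \<Gamma> \<longleftrightarrow> a \<in> C \<and> 1 \<le> r \<and> r \<le> p"
  by (auto simp: subdiv_circulant_def)

lemma path_in_verts: "a \<in> C \<Longrightarrow> 0 \<le> r \<Longrightarrow> r \<le> p + 1 \<Longrightarrow> path a r \<in> pverts \<Gamma>"
  by (auto simp: subdiv_path_def)

lemma verts_on_path:
  assumes "v \<in> pverts \<Gamma>"
  obtains a r where "a \<in> C" "0 \<le> r" "r \<le> p" "v = path a r"
proof (cases v)
  case (U a)
  then show ?thesis using that[of a 0] assms p_pos by simp
next
  case (V a r)
  then show ?thesis using that[of a r] assms path_inner by simp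
qed

lemma finite_verts: "finite (pverts \<Gamma>)"
proof -
  interpret G: pair_graph \<Gamma>
    by (rule pair_graph_subdiv_circulant) (use i_pos i_less_j two_j_less p_pos in auto)
  show ?thesis by (rule G.pair_finite_verts)
qed

lemma arc_sym: "(x, y) \<in> parcs \<Gamma> \<Longrightarrow> (y, x) \<in> parcs \<Gamma>"
  by (auto simp: subdiv_circulant_def)

lemma arc_i: "a \<in> C \<Longrightarrow> (U a, U ((a + i) mod n)) \<in> parcs \<Gamma>"
  by (auto simp: subdiv_circulant_def subdiv_edges_def)

lemma arc_path: "a \<in> C \<Longrightarrow> 0 \<le> r \<Longrightarrow> r \<le> p \<Longrightarrow> (path a r, path a (r + 1)) \<in> parcs \<Gamma>"
  by (auto simp: subdiv_circulant_def subdiv_edges_def)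

lemma arc_cases [consumes 1, case_names i i_rev path path_rev]:
  assumes "(x, y) \<in> parcs \<Gamma>"
  obtains a where "a \<in> C" "x = U a" "y = U ((a + i) mod n)"
    | a where "a \<in> C" "y = U a" "x = U ((a + i) mod n)"
    | a r where "a \<in> C" "0 \<le> r" "r \<le> p" "x = path a r" "y = path a (r + 1)"
    | a r where "a \<in> C" "0 \<le> r" "r \<le> p" "y = path a r" "x = path a (r + 1)"
  using assms by (auto simp: subdiv_circulant_def subdiv_edges_def)

lemma shift_inverse: "a \<in> C \<Longrightarrow> ((a + k) mod n - k) mod n = a"
  by (simp add: mod_diff_left_eq)

lemma path_eq_U:
  assumes "0 \<le> r" "r \<le> p + 1" "path a r = U c"
  shows "r = 0 \<and> c = a \<or> r = p + 1 \<and> c = (a + j) mod n"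
  using assms p_pos by (auto simp: subdiv_path_def split: if_splits)

lemma path_eq_V:
  assumes "path a r = V c q"
  shows "a = c \<and> r = q"
  using assms by (auto simp: subdiv_path_def split: if_splits)

lemma arc_U_U:
  assumes "(U a, U b) \<in> parcs \<Gamma>"
  shows "b = (a + i) mod n \<or> b = (a - i) mod n"
  using assms
proof (cases rule: arc_cases)
  case (path c r)
  then show ?thesis using path_eq_U[of r c a] path_eq_U[of "r + 1" c b] p_pos by auto
next
  case (path_rev c r)
  then show ?thesis using path_eq_U[of r c b] path_eq_U[of "r + 1" c a] p_pos by auto
qed (use shift_inverse in auto)

lemma arc_U_V:
  assumes "(U a, V b q) \<in> parcs \<Gamma>"
  shows "b = a \<and> q = 1 \<or> b = (a - j) mod n \<and> q = p"
  using assms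
proof (cases rule: arc_cases)
  case (path c r)
  then show ?thesis using path_eq_U[of r c a] path_eq_V[of c "r + 1" b q] p_pos by auto
next
  case (path_rev c r)
  then have "path c r = V b q" "path c (r + 1) = U a" by auto
  then show ?thesis
    using path_rev path_eq_U[of "r + 1" c a] path_eq_V[of c r b q] shift_inverse[of c j] by auto
qed auto

lemma arc_path_inner:
  assumes "(path c q, y) \<in> parcs \<Gamma>" "1 \<le> q" "q \<le> p"
  shows "y = path c (q - 1) \<or> y = path c (q + 1)"
proof -
  have V: "path c q = V c q" using assms path_inner by simp
  show ?thesis using assms(1) unfolding V
  proof (cases rule: arc_cases)
    case (path a r)
    then show ?thesis using path_eq_V[of a r c q] by auto
  next
    case (path_rev a r)
    then show ?thesis using path_eq_V[of a "r + 1" c q] by auto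
  qed auto
qed

text \<open>
  The two cases of the action are one rule: \<open>(s, t)\<close> maps each subdivided path onto a subdivided
  path, traversed in the same direction if \<open>t * j \<equiv> j\<close> and backwards otherwise. The rule includes both
  ends of the path, so that arcs and composites need no separate treatment of the \<open>u\<^sub>a\<close>.
\<close>

lemma subdiv_action_path:
  assumes t: "t \<in> H' n i j" and a: "a \<in> C" and r: "0 \<le> r" "r \<le> p + 1"
  shows "subdiv_action n i j p (s, t) (path a r) =
    (if [t * j = j] (mod n) then path ((s + t * a) mod n) r
     else path ((s + t * a - j) mod n) (p + 1 - r))"
proof -
  consider "r = 0" | "1 \<le> r" "r \<le> p" | "r = p + 1" using r by linarith
  then show ?thesis
  proof cases
    case 1
    then show ?thesis using a by (simp add: subdiv_action_def mod_add_left_eq)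
  next
    case 2
    then show ?thesis using a by (simp add: subdiv_action_def path_inner)
  next
    case 3
    have "(s + t * ((a + j) mod n)) mod n = (s + t * a + t * j) mod n"
      by (metis (no_types) add.assoc distrib_left mod_add_right_eq mod_mult_right_eq)
    moreover have "(s + t * a + t * j) mod n = (s + t * a + j) mod n" if "[t * j = j] (mod n)"
      using that by (rule mod_add_cong_right)
    moreover have "(s + t * a + t * j) mod n = (s + t * a - j) mod n" if "\<not> [t * j = j] (mod n)"
      using that t mod_add_cong_right[of "t * j" "- j" n "s + t * a"] by (simp add: mem_H'_iff)
    ultimately show ?thesis
      using 3 by (simp add: subdiv_action_def mod_add_left_eq)
  qed
qed

lemma subdiv_action_U [simp]: "a \<in> C \<Longrightarrow> subdiv_action n i j p (s, t) (U a) = U ((s + t * a) mod n)"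
  by (simp add: subdiv_action_def)

lemma subdiv_action_arc:
  assumes t: "t \<in> H' n i j" and arc: "(v, w) \<in> parcs \<Gamma>"
  shows "(subdiv_action n i j p (s, t) v, subdiv_action n i j p (s, t) w) \<in> parcs \<Gamma>"
    (is "(?f v, ?f w) \<in> _")
proof -
  have i_arc: "(?f (U a), ?f (U ((a + i) mod n))) \<in> parcs \<Gamma>" if a: "a \<in> C" for a
  proof -
    have ti: "(s + t * ((a + i) mod n)) mod n = ((s + t * a) mod n + t * i) mod n"
      by (metis (no_types) add.assoc distrib_left mod_add_left_eq mod_add_right_eq mod_mult_right_eq)
    from t consider "[t * i = i] (mod n)" | "[t * i = - i] (mod n)" by (auto simp: mem_H'_iff)
    then show ?thesis
    proof cases
      case 1
      then have "(s + t * ((a + i) mod n)) mod n = ((s + t * a) mod n + i) mod n"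
        unfolding ti by (rule mod_add_cong_right)
      then show ?thesis using a arc_i[of "(s + t * a) mod n"] by simp
    next
      case 2
      then have "(s + t * ((a + i) mod n)) mod n = ((s + t * a) mod n + - i) mod n"
        unfolding ti by (rule mod_add_cong_right)
      then have "((s + t * ((a + i) mod n)) mod n + i) mod n = (s + t * a) mod n"
        by (simp add: mod_add_left_eq)
      then show ?thesis using a arc_sym[OF arc_i[of "(s + t * ((a + i) mod n)) mod n"]] by simp
    qed
  qed
  have path_arc: "(?f (path a r), ?f (path a (r + 1))) \<in> parcs \<Gamma>"
    if "a \<in> C" "0 \<le> r" "r \<le> p" for a r
    using that arc_path[of "(s + t * a) mod n" r] arc_sym[OF arc_path[of "(s + t * a - j) mod n" "p - r"]]
    by (simp add: subdiv_action_path[OF t] algebra_simps)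
  from arc show ?thesis
    by (cases rule: arc_cases) (use i_arc path_arc arc_sym in auto)
qed

lemma subdiv_action_mult:
  assumes x: "(s, t) \<in> carrier (semidirect n i j)" and y: "(s', t') \<in> carrier (semidirect n i j)"
    and v: "v \<in> pverts \<Gamma>"
  shows "subdiv_action n i j p ((s, t) \<otimes>\<^bsub>semidirect n i j\<^esub> (s', t')) v =
    subdiv_action n i j p (s, t) (subdiv_action n i j p (s', t') v)"
proof -
  interpret S: group "semidirect n i j" using group_semidirect n_gt_1 .
  have t: "t \<in> H' n i j" "t' \<in> H' n i j" using x y by (simp_all add: mem_semidirect_iff)
  have tt': "t * t' mod n \<in> H' n i j"
    using S.m_closed[OF x y] by (simp add: semidirect_def)
  obtain a r where v: "a \<in> C" "0 \<le> r" "r \<le> p" "v = path a r" using verts_on_path[OF v] .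
  have sign: "[x * j = j] (mod n) \<or> [x * j = - j] (mod n)" if "x \<in> H' n i j" for x
    using that by (simp add: mem_H'_iff)
  have "[t * t' mod n * j = t * (t' * j)] (mod n)"
    by (simp add: cong_def mod_mult_left_eq mult.assoc)
  moreover have "[t * (t' * j) = t * j] (mod n)" if "[t' * j = j] (mod n)"
    using that by (rule cong_scalar_left)
  moreover have "[t * (t' * j) = - (t * j)] (mod n)" if "[t' * j = - j] (mod n)"
    using cong_scalar_left[OF that, of t] by simp
  \<comment> \<open>Two reversals cancel.\<close>
  ultimately have tt'_iff: "[t * t' mod n * j = j] (mod n) \<longleftrightarrow> ([t * j = j] (mod n) \<longleftrightarrow> [t' * j = j] (mod n))"
    using sign[OF t(1)] sign[OF t(2)] j_not_cong_minus_j cong_minus_minus_iff[of "t * j" j n]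
      cong_minus_minus_iff[of "t * j" "- j" n]
    by (smt (verit) cong_sym cong_trans minus_minus)
  have prod: "((s + t * s') mod n + t * t' mod n * a - k) mod n = (s + t * ((s' + t' * a) mod n) - k) mod n" for k
    by (metis affine_compose_mod mod_diff_left_eq)
  have shifted: "(s + t * ((s' + t' * a - j) mod n)) mod n = (s + t * ((s' + t' * a) mod n) - t * j) mod n"
  proof -
    have "[s + t * ((s' + t' * a - j) mod n) = s + t * (s' + t' * a - j)] (mod n)"
      by (intro cong_add cong_mult) (simp_all add: cong_def)
    also have "s + t * (s' + t' * a - j) = s + t * (s' + t' * a) - t * j" by (simp add: algebra_simps)
    also have "[s + t * (s' + t' * a) - t * j = s + t * ((s' + t' * a) mod n) - t * j] (mod n)"
      by (intro cong_add cong_diff cong_mult) (simp_all add: cong_def)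
    finally show ?thesis by (simp add: cong_def)
  qed
  have neg: "[- (t * j) = - j] (mod n) \<or> [- (t * j) = j] (mod n)"
    using sign[OF t(1)] cong_minus_minus_iff[of "t * j" j n] cong_minus_minus_iff[of "t * j" "- j" n]
    by auto
  have tj: "(b - t * j) mod n = (if [t * j = j] (mod n) then (b - j) mod n else (b + j) mod n)" for b
    using neg mod_add_cong_right[of "- (t * j)" "- j" n b] mod_add_cong_right[of "- (t * j)" j n b]
      cong_minus_minus_iff[of "t * j" j n] by auto
  have tj': "(b - t * j - j) mod n = b mod n" if "\<not> [t * j = j] (mod n)" for b
    using tj[of b] that by (metis add_diff_cancel_right' mod_diff_left_eq)
  have lhs: "subdiv_action n i j p ((s, t) \<otimes>\<^bsub>semidirect n i j\<^esub> (s', t')) v =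
    (if [t * t' mod n * j = j] (mod n) then path ((s + t * ((s' + t' * a) mod n)) mod n) r
     else path ((s + t * ((s' + t' * a) mod n) - j) mod n) (p + 1 - r))"
    using subdiv_action_path[OF tt' v(1,2), of "(s + t * s') mod n"] v prod[of 0] prod[of j]
    by (simp add: semidirect_def)
  show ?thesis
  proof (cases "[t' * j = j] (mod n)")
    case True
    then show ?thesis
      unfolding lhs tt'_iff using v
      by (simp add: subdiv_action_path[OF t(1)] subdiv_action_path[OF t(2)])
  next
    case False
    have "(s + t * ((s' + t' * a - j) mod n) - j) mod n = (s + t * ((s' + t' * a) mod n)) mod n"
      if "\<not> [t * j = j] (mod n)"
      using shifted tj'[OF that] by (metis mod_diff_left_eq)
    then show ?thesis
      unfolding lhs tt'_iff using v False
      by (simp add: subdiv_action_path[OF t(1)] subdiv_action_path[OF t(2)] shifted tj)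
  qed
qed

lemma subdiv_action_hom:
  "subdiv_action n i j p \<in> hom (semidirect n i j) (aut_group \<Gamma>)"
proof (rule hom_aut_groupI)
  show "group (semidirect n i j)" using group_semidirect n_gt_1 .
  show "subdiv_action n i j p x \<in> extensional (pverts \<Gamma>)" for x
    by (cases x) (simp add: subdiv_action_def)
  show "subdiv_action n i j p x v \<in> pverts \<Gamma>"
    if x: "x \<in> carrier (semidirect n i j)" and v: "v \<in> pverts \<Gamma>" for x v
  proof -
    obtain s t where st: "x = (s, t)" "t \<in> H' n i j" using x by (cases x) (simp add: mem_semidirect_iff)
    obtain a r where "a \<in> C" "0 \<le> r" "r \<le> p" "v = path a r" using verts_on_path[OF v] .
    then show ?thesis using st by (simp add: subdiv_action_path path_in_verts)
  qed
  show "subdiv_action n i j p (x \<otimes>\<^bsub>semidirect n i j\<^esub> y) v =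
      subdiv_action n i j p x (subdiv_action n i j p y v)"
    if "x \<in> carrier (semidirect n i j)" "y \<in> carrier (semidirect n i j)" "v \<in> pverts \<Gamma>" for x y v
    using that subdiv_action_mult by (cases x; cases y) blast
  show "subdiv_action n i j p \<one>\<^bsub>semidirect n i j\<^esub> v = v" if "v \<in> pverts \<Gamma>" for v
    using that by (cases v) (auto simp: semidirect_def subdiv_action_def)
  show "(subdiv_action n i j p x v, subdiv_action n i j p x w) \<in> parcs \<Gamma>"
    if "x \<in> carrier (semidirect n i j)" "(v, w) \<in> parcs \<Gamma>" for x v w
    using that subdiv_action_arc by (cases x) (simp add: mem_semidirect_iff)
qed

end

section \<open>Automorphisms of the subdivided graph\<close>

text \<open>
  The one critical case is \<open>p = 1\<close>: both vertices are then ends of the path, and they differ because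
  \<open>j \<not>\<equiv> 0\<close>.
\<close>

lemma (in subdiv_params) path_two_apart:
  assumes "a \<in> C" "0 \<le> r" "r + 1 \<le> p"
  shows "path a r \<noteq> path a (r + 1 + 1)"
proof
  assume eq: "path a r = path a (r + 1 + 1)"
  then have "r = 0" "p = 1" using assms by (auto simp: subdiv_path_def split: if_splits)
  then have "a = (a + j) mod n" using eq by (simp add: subdiv_path_def)
  then have "[a + j = a + 0] (mod n)" using assms by (simp add: cong_def)
  then show False using not_dvd(1) by (simp only: cong_add_lcancel cong_0_iff)
qed

locale subdiv_automorphism = subdiv_params +
  fixes \<alpha> :: "subdiv_vertex \<Rightarrow> subdiv_vertex"
  assumes aut: "\<alpha> \<in> carrier (aut_group \<Gamma>)"
begin

lemma aut_in_verts: "v \<in> pverts \<Gamma> \<Longrightarrow> \<alpha> v \<in> pverts \<Gamma>"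
  and aut_inj: "inj_on \<alpha> (pverts \<Gamma>)"
  and aut_extensional: "\<alpha> \<in> extensional (pverts \<Gamma>)"
  using aut by (auto simp: aut_group_def Bij_def bij_betw_def)

lemma aut_eq_iff: "v \<in> pverts \<Gamma> \<Longrightarrow> w \<in> pverts \<Gamma> \<Longrightarrow> \<alpha> v = \<alpha> w \<longleftrightarrow> v = w"
  using aut_inj by (rule inj_on_eq_iff)

lemma aut_arc:
  assumes "(v, w) \<in> parcs \<Gamma>"
  shows "(\<alpha> v, \<alpha> w) \<in> parcs \<Gamma>"
proof -
  interpret G: pair_graph \<Gamma>
    by (rule pair_graph_subdiv_circulant) (use i_pos i_less_j two_j_less p_pos in auto)
  have "v \<in> pverts \<Gamma>" "w \<in> pverts \<Gamma>"
    using G.in_arcsD1[of v w] G.in_arcsD2[of v w] assms by auto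
  then show ?thesis using aut assms by (auto simp: aut_group_def)
qed

text \<open>
  An inner vertex of a subdivided path has at most two neighbours, but \<open>u\<^sub>a\<close> has the three neighbours
  \<open>u\<^sub>a\<^sub>+\<^sub>i\<close>, \<open>u\<^sub>a\<^sub>-\<^sub>i\<close> and \<open>v\<^sub>a\<^sup>1\<close>.
\<close>

lemma aut_U:
  assumes a: "a \<in> C"
  obtains c where "c \<in> C" "\<alpha> (U a) = U c"
proof (cases "\<alpha> (U a)")
  case (U c)
  then show ?thesis using that aut_in_verts[of "U a"] a by auto
next
  case (V b r)
  let ?x = "U ((a + i) mod n)" and ?y = "U ((a - i) mod n)" and ?z = "V a 1"
  have br: "b \<in> C" "1 \<le> r" "r \<le> p" using V aut_in_verts[of "U a"] a by auto
  have verts: "?x \<in> pverts \<Gamma>" "?y \<in> pverts \<Gamma>" "?z \<in> pverts \<Gamma>" using a p_pos by auto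
  have "(U a, ?x) \<in> parcs \<Gamma>" using arc_i a .
  moreover have "(U a, ?y) \<in> parcs \<Gamma>"
    using arc_sym[OF arc_i[of "(a - i) mod n"]] a by (simp add: mod_add_left_eq)
  moreover have "(U a, ?z) \<in> parcs \<Gamma>"
    using arc_path[of a 0] a p_pos path_inner[of 1 a] by simp
  ultimately have "\<alpha> w = path b (r - 1) \<or> \<alpha> w = path b (r + 1)" if "w \<in> {?x, ?y, ?z}" for w
    using that aut_arc[of "U a" w] V br arc_path_inner[of b r "\<alpha> w"] path_inner[of r b] by auto
  then have "\<alpha> ?x = \<alpha> ?y \<or> \<alpha> ?x = \<alpha> ?z \<or> \<alpha> ?y = \<alpha> ?z" by (metis insertCI)
  then have "?x = ?y" unfolding aut_eq_iff[OF verts(1,2)] aut_eq_iff[OF verts(1,3)] aut_eq_iff[OF verts(2,3)]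
    by simp
  then have "[a + i = a - i] (mod n)" by (simp add: cong_def)
  then have False using not_dvd(2) by (simp add: cong_iff_dvd_diff)
  then show ?thesis ..
qed

text \<open>An injective map of the finite set of all \<open>u\<^sub>a\<close> into itself already has all of them as values.\<close>

lemma aut_V:
  assumes v: "V a r \<in> pverts \<Gamma>"
  obtains c q where "V c q \<in> pverts \<Gamma>" "\<alpha> (V a r) = V c q"
proof (cases "\<alpha> (V a r)")
  case (U c)
  have "\<alpha> ` (U ` C) = U ` C"
  proof (rule endo_inj_surj)
    show "finite (U ` C)" by (rule finite_subset[OF _ finite_verts]) auto
    show "\<alpha> ` U ` C \<subseteq> U ` C" using aut_U by blast
    show "inj_on \<alpha> (U ` C)" by (rule inj_on_subset[OF aut_inj]) auto
  qed
  moreover have "U c \<in> U ` C" using U v aut_in_verts[of "V a r"] by auto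
  ultimately have "U c \<in> \<alpha> ` U ` C" by simp
  then obtain b where "b \<in> C" "\<alpha> (U b) = U c" by auto
  then have "V a r = U b" using aut_eq_iff[of "V a r" "U b"] U v by simp
  then show ?thesis by simp
next
  case (V c q)
  then have "V c q \<in> pverts \<Gamma>" using v aut_in_verts by metis
  then show ?thesis using that V by blast
qed

text \<open>
  Inner vertices of a path have no neighbours off the path, so an injective map that preserves arcs and
  has started along a path \<open>Q\<close> cannot leave it. The function \<open>Q\<close> stands for a subdivided path
  traversed in either direction.
\<close>

lemma aut_follows_path:
  assumes a: "a \<in> C"
    and Q: "\<And>r y. 1 \<le> r \<Longrightarrow> r \<le> p \<Longrightarrow> (Q r, y) \<in> parcs \<Gamma> \<Longrightarrow> y = Q (r - 1) \<or> y = Q (r + 1)"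
    and start: "\<alpha> (path a 0) = Q 0" "\<alpha> (path a 1) = Q 1"
    and r: "0 \<le> r" "r \<le> p + 1"
  shows "\<alpha> (path a r) = Q r"
proof -
  have step: "r \<le> p \<longrightarrow> \<alpha> (path a r) = Q r \<and> \<alpha> (path a (r + 1)) = Q (r + 1)" if "0 \<le> r" for r
    using that
  proof (induction r rule: int_ge_induct)
    case base
    then show ?case using start by simp
  next
    case (step r)
    show ?case
    proof
      assume r: "r + 1 \<le> p"
      then have IH: "\<alpha> (path a r) = Q r" "\<alpha> (path a (r + 1)) = Q (r + 1)" using step.IH by auto
      have "(Q (r + 1), \<alpha> (path a (r + 1 + 1))) \<in> parcs \<Gamma>"
        using aut_arc[OF arc_path[of a "r + 1"]] a r step.hyps IH by simp
      then have "\<alpha> (path a (r + 1 + 1)) = Q r \<or> \<alpha> (path a (r + 1 + 1)) = Q (r + 1 + 1)"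
        using Q[of "r + 1"] r step.hyps by simp
      moreover have "\<alpha> (path a (r + 1 + 1)) \<noteq> \<alpha> (path a r)"
        using path_two_apart[of a r] aut_eq_iff[OF path_in_verts path_in_verts, of a "r + 1 + 1" a r]
          a r step.hyps by auto
      ultimately show "\<alpha> (path a (r + 1)) = Q (r + 1) \<and> \<alpha> (path a (r + 1 + 1)) = Q (r + 1 + 1)"
        using IH by auto
    qed
  qed
  show ?thesis
  proof (cases "r \<le> p")
    case True
    then show ?thesis using step r by blast
  next
    case False
    then have "r = p + 1" using r by simp
    then show ?thesis using step[of p] p_pos by simp
  qed
qed

text \<open>
  The image of \<open>v\<^sub>a\<^sup>1\<close> is one of the two neighbours of \<open>u\<^sub>c\<close> that lie inside a subdivided path: the
  first vertex of the path from \<open>u\<^sub>c\<close>, or the last one of the path to \<open>u\<^sub>c\<close>.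
\<close>

lemma aut_path_cases:
  assumes a: "a \<in> C" and c: "\<alpha> (U a) = U c"
  shows "(\<forall>r\<in>{0..p + 1}. \<alpha> (path a r) = path c r) \<or>
    (\<forall>r\<in>{0..p + 1}. \<alpha> (path a r) = path ((c - j) mod n) (p + 1 - r))"
proof -
  have cC: "c \<in> C" using aut_in_verts[of "U a"] a c by simp
  have V1: "path a 1 = V a 1" using path_inner p_pos by simp
  obtain b q where bq: "\<alpha> (V a 1) = V b q" using aut_V[of a 1] a p_pos by (metis V_in_verts order_refl)
  have "(U c, V b q) \<in> parcs \<Gamma>"
    using aut_arc[OF arc_path[of a 0]] a c p_pos V1 bq by simp
  then consider "b = c" "q = 1" | "b = (c - j) mod n" "q = p" using arc_U_V by blast
  then show ?thesis
  proof cases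
    case 1
    have "\<alpha> (path a r) = path c r" if "r \<in> {0..p + 1}" for r
    proof (rule aut_follows_path[OF a])
      show "\<alpha> (path a 1) = path c 1" using 1 bq V1 path_inner p_pos by simp
    qed (use arc_path_inner c that in auto)
    then show ?thesis by blast
  next
    case 2
    have "\<alpha> (path a r) = path ((c - j) mod n) (p + 1 - r)" if "r \<in> {0..p + 1}" for r
    proof (rule aut_follows_path[OF a])
      show "\<alpha> (path a 0) = path ((c - j) mod n) (p + 1 - 0)" using c cC by (simp add: mod_add_left_eq)
      show "\<alpha> (path a 1) = path ((c - j) mod n) (p + 1 - 1)" using 2 bq V1 path_inner p_pos by simp
      show "y = path ((c - j) mod n) (p + 1 - (r - 1)) \<or> y = path ((c - j) mod n) (p + 1 - (r + 1))"
        if "1 \<le> r" "r \<le> p" "(path ((c - j) mod n) (p + 1 - r), y) \<in> parcs \<Gamma>" for r y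
        using arc_path_inner[OF that(3)] that(1,2) by (auto simp: algebra_simps)
    qed (use that in auto)
    then show ?thesis by blast
  qed
qed

lemma aut_eq_action:
  assumes units: "i = 1 \<or> \<not> coprime i n \<and> \<not> coprime j n"
  shows "\<exists>x \<in> carrier (semidirect n i j). \<alpha> = subdiv_action n i j p x"
proof -
  have "\<exists>c. c \<in> C \<and> \<alpha> (U (a mod n)) = U c" for a using aut_U mod_mem_C by metis
  then obtain f where f: "\<And>a. f a \<in> C" "\<And>a. \<alpha> (U (a mod n)) = U (f a)" by metis
  have inj: "[f a = f b] (mod n) \<longleftrightarrow> [a = b] (mod n)" for a b
  proof
    assume "[f a = f b] (mod n)"
    then have "f a = f b" using cong_C_eq f(1) by blast
    then have "\<alpha> (U (a mod n)) = \<alpha> (U (b mod n))" by (simp add: f(2))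
    then have "U (a mod n) = U (b mod n)" using aut_eq_iff by simp
    then show "[a = b] (mod n)" by (simp add: cong_def)
  next
    assume "[a = b] (mod n)"
    then have "U (f a) = U (f b)" using f(2)[of a] f(2)[of b] by (simp add: cong_def)
    then show "[f a = f b] (mod n)" by simp
  qed
  have step_i: "[f (a + i) = f a + i] (mod n) \<or> [f (a + i) = f a - i] (mod n)" for a
  proof -
    have "(\<alpha> (U (a mod n)), \<alpha> (U ((a + i) mod n))) \<in> parcs \<Gamma>"
      using aut_arc[OF arc_i[of "a mod n"]] by (simp add: mod_add_left_eq)
    then have "f (a + i) = (f a + i) mod n \<or> f (a + i) = (f a - i) mod n"
      using arc_U_U f(2) by simp
    then show ?thesis by (auto simp: cong_def)
  qed
  \<comment> \<open>The direction of each image path fixes the sign of the \<open>j\<close>-step, by its value at the far end.\<close>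
  have path_f: "(\<forall>r\<in>{0..p + 1}. \<alpha> (path (a mod n) r) = path (f a) r) \<and> [f (a + j) = f a + j] (mod n) \<or>
    (\<forall>r\<in>{0..p + 1}. \<alpha> (path (a mod n) r) = path ((f a - j) mod n) (p + 1 - r)) \<and>
      [f (a + j) = f a - j] (mod n)" for a
  proof -
    have last: "\<alpha> (path (a mod n) (p + 1)) = U (f (a + j))"
      using f(2)[of "a + j"] by (simp add: mod_add_left_eq)
    have end_mem: "p + 1 \<in> {0..p + 1}" using p_pos by simp
    from aut_path_cases[OF mod_mem_C f(2)[of a]] show ?thesis
    proof (elim disjE)
      assume *: "\<forall>r\<in>{0..p + 1}. \<alpha> (path (a mod n) r) = path (f a) r"
      then have "path (f a) (p + 1) = U (f (a + j))" using last bspec[OF * end_mem] by simp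
      then have "f (a + j) = (f a + j) mod n" by simp
      with * show ?thesis by (simp add: cong_def)
    next
      assume *: "\<forall>r\<in>{0..p + 1}. \<alpha> (path (a mod n) r) = path ((f a - j) mod n) (p + 1 - r)"
      then have "path ((f a - j) mod n) (p + 1 - (p + 1)) = U (f (a + j))"
        using last bspec[OF * end_mem] by simp
      then have "f (a + j) = (f a - j) mod n" by simp
      with * show ?thesis by (simp add: cong_def)
    qed
  qed
  obtain t where t: "\<And>a. [f a = f 0 + t * a] (mod n)"
      "[t * i = i] (mod n) \<or> [t * i = - i] (mod n)" "[t * j = j] (mod n) \<or> [t * j = - j] (mod n)"
    using sign_step_map_affine[OF units inj step_i] path_f by blast
  define s u where "s = f 0" and "u = t mod n"
  have uk: "[u * k = t * k] (mod n)" for k by (simp add: u_def cong_def mod_mult_left_eq)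
  have fu: "f a = (s + u * a) mod n" for a
  proof -
    have "f a = f a mod n" using f(1) by simp
    also have "\<dots> = (s + t * a) mod n" using t(1)[of a] by (simp add: s_def cong_def)
    also have "\<dots> = (s + u * a) mod n" by (rule mod_add_cong_right) (rule cong_sym[OF uk])
    finally show ?thesis .
  qed
  have u: "u \<in> H' n i j"
    unfolding mem_H'_iff using t(2,3) uk[of i] uk[of j] cong_trans u_def mod_mem_C by metis
  have su: "(s, u) \<in> carrier (semidirect n i j)"
    using u f(1) by (simp add: mem_semidirect_iff s_def)
  have f_j: "[f (a + j) = f a + u * j] (mod n)" for a
    by (simp add: fu cong_def mod_simps algebra_simps)
  \<comment> \<open>Conversely, as \<open>j \<not>\<equiv> - j\<close>, the sign of \<open>u * j\<close> tells the direction in which \<open>\<alpha>\<close> runs.\<close>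
  have "\<alpha> v = subdiv_action n i j p (s, u) v" if v: "v \<in> pverts \<Gamma>" for v
  proof -
    obtain a r where a: "a \<in> C" and r: "0 \<le> r" "r \<le> p" and ar: "v = path a r" using verts_on_path[OF v] .
    have r': "r \<in> {0..p + 1}" using r by simp
    from path_f[of a] show ?thesis
    proof (elim disjE conjE)
      assume *: "\<forall>r\<in>{0..p + 1}. \<alpha> (path (a mod n) r) = path (f a) r" "[f (a + j) = f a + j] (mod n)"
      have "[f a + u * j = f a + j] (mod n)" using f_j cong_sym cong_trans *(2) by blast
      then have "[u * j = j] (mod n)" by (simp only: cong_add_lcancel)
      then show ?thesis using *(1) r' a r fu[of a] by (simp add: ar subdiv_action_path[OF u])
    next
      assume *: "\<forall>r\<in>{0..p + 1}. \<alpha> (path (a mod n) r) = path ((f a - j) mod n) (p + 1 - r)"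
        "[f (a + j) = f a - j] (mod n)"
      have "[f a + u * j = f a + - j] (mod n)" using f_j[of a] cong_sym cong_trans *(2) by fastforce
      then have "[u * j = - j] (mod n)" by (simp only: cong_add_lcancel)
      then have "\<not> [u * j = j] (mod n)" using j_not_cong_minus_j cong_sym cong_trans by blast
      then show ?thesis
        using *(1) r' a r fu[of a] by (simp add: ar subdiv_action_path[OF u] mod_diff_left_eq)
    qed
  qed
  then have "\<alpha> = subdiv_action n i j p (s, u)"
    by (intro extensionalityI[OF aut_extensional]) (simp_all add: subdiv_action_def)
  then show ?thesis using su by blast
qed

end

theorem theorem24:
  fixes n i j p :: int
  assumes "0 < i" and "i < j" and "real_of_int j \<le> real_of_int n / 2" and "p \<ge> 1"
    and "i = 1 \<or> (i \<notin> Units (residue_ring n) \<and> j \<notin> Units (residue_ring n))"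
    and "connected (circulant n i j)"
    and "real_of_int j < real_of_int n / 2"
  shows
    "(\<forall>\<alpha>' \<in> carrier (aut_group (circulant n i j)).
        (\<exists>\<^sub>\<le>\<^sub>1\<alpha>. \<alpha> \<in> carrier (aut_group (subdiv_circulant n i j p)) \<and> extends_on_U n \<alpha> \<alpha>') \<and>
        ((\<exists>\<alpha> \<in> carrier (aut_group (subdiv_circulant n i j p)). extends_on_U n \<alpha> \<alpha>') \<longleftrightarrow>
         \<alpha>' \<in> circulant_action n ` carrier (semidirect n i j))) \<and>
     (\<forall>x \<in> carrier (semidirect n i j).
        circulant_action n x \<in> carrier (aut_group (circulant n i j)) \<and>
        subdiv_action n i j p x \<in> carrier (aut_group (subdiv_circulant n i j p)) \<and>
        extends_on_U n (subdiv_action n i j p x) (circulant_action n x)) \<and>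
     subdiv_action n i j p \<in> iso (semidirect n i j) (aut_group (subdiv_circulant n i j p))"
proof -
  have n: "1 < n" and two_j: "2 * j < n" using assms(1,2,7) by linarith+
  interpret subdiv_params n i j p
    by unfold_locales (use assms(1,2,4) two_j gcd_1_if_circulant_connected[OF assms(6) n] in auto)
  let ?K = "semidirect n i j" and ?A = "subdiv_action n i j p" and ?B = "circulant_action n"
  have units: "i = 1 \<or> \<not> coprime i n \<and> \<not> coprime j n"
    using assms(1,2,5) two_j by (auto simp: Units_eq mem_C)
  have surj: "\<exists>x \<in> carrier ?K. \<alpha> = ?A x" if "\<alpha> \<in> carrier (aut_group \<Gamma>)" for \<alpha>
  proof -
    interpret subdiv_automorphism n i j p \<alpha> by unfold_locales (rule that)
    show ?thesis by (rule aut_eq_action[OF units])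
  qed
  have A: "?A x \<in> carrier (aut_group \<Gamma>)" and B: "?B x \<in> carrier (aut_group (circulant n i j))"
    if "x \<in> carrier ?K" for x
    using hom_in_carrier[OF subdiv_action_hom that] hom_in_carrier[OF circulant_action_hom that]
    by simp_all
  have AB: "extends_on_U n (?A x) (?B x)" for x
    by (cases x) (simp add: extends_on_U_def circulant_action_def)
  have eq_if_eq_on_U: "x = y"
    if x: "x \<in> carrier ?K" and y: "y \<in> carrier ?K" and eq: "\<And>a. a \<in> C \<Longrightarrow> ?A x (U a) = ?A y (U a)" for x y
  proof -
    obtain s t s' t' where st: "x = (s, t)" "y = (s', t')" by (cases x, cases y) auto
    have mem: "s \<in> C" "s' \<in> C" "t \<in> C" "t' \<in> C" using x y st by (auto simp: mem_semidirect_iff mem_H'_iff)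
    \<comment> \<open>An affine map is determined by its values at \<open>0\<close> and \<open>1\<close>.\<close>
    have 01: "0 \<in> C" "1 \<in> C" using n by (simp_all add: mem_C)
    have s: "s = s'" using eq[OF 01(1)] mem 01 by (simp add: st)
    have "(s + t) mod n = (s' + t') mod n" using eq[OF 01(2)] 01 by (simp add: st)
    then have "[s + t = s + t'] (mod n)" by (simp add: s cong_def)
    then have "t = t'" using mem cong_C_eq by (simp only: cong_add_lcancel)
    then show ?thesis using s st by simp
  qed
  have unique: "\<alpha> = \<beta>"
    if auts: "\<alpha> \<in> carrier (aut_group \<Gamma>)" "\<beta> \<in> carrier (aut_group \<Gamma>)"
      and ext: "extends_on_U n \<alpha> \<alpha>'" "extends_on_U n \<beta> \<alpha>'" for \<alpha> \<beta> \<alpha>'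
  proof -
    obtain x y where "x \<in> carrier ?K" "\<alpha> = ?A x" "y \<in> carrier ?K" "\<beta> = ?A y"
      using surj auts by blast
    then show ?thesis using ext eq_if_eq_on_U[of x y] by (auto simp: extends_on_U_def)
  qed
  have restriction: "(\<exists>\<alpha> \<in> carrier (aut_group \<Gamma>). extends_on_U n \<alpha> \<alpha>') \<longleftrightarrow> \<alpha>' \<in> ?B ` carrier ?K"
    if \<alpha>': "\<alpha>' \<in> carrier (aut_group (circulant n i j))" for \<alpha>'
  proof
    assume "\<exists>\<alpha> \<in> carrier (aut_group \<Gamma>). extends_on_U n \<alpha> \<alpha>'"
    then obtain x where x: "x \<in> carrier ?K" "extends_on_U n (?A x) \<alpha>'" using surj by blast
    have "\<alpha>' a = ?B x a" if "a \<in> C" for a using x(2) AB[of x] that by (simp add: extends_on_U_def)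
    moreover have "\<alpha>' \<in> extensional C" "?B x \<in> extensional C"
      using \<alpha>' B[OF x(1)] by (auto simp: aut_group_def Bij_def circulant_def)
    ultimately have "\<alpha>' = ?B x" by (intro extensionalityI)
    then show "\<alpha>' \<in> ?B ` carrier ?K" using x(1) by blast
  qed (use A AB in blast)
  have "bij_betw ?A (carrier ?K) (carrier (aut_group \<Gamma>))"
  proof (rule bij_betw_imageI)
    show "inj_on ?A (carrier ?K)" by (rule inj_onI) (simp add: eq_if_eq_on_U)
    show "?A ` carrier ?K = carrier (aut_group \<Gamma>)" using surj A by blast
  qed
  then have iso: "?A \<in> iso ?K (aut_group \<Gamma>)" using subdiv_action_hom by (simp add: iso_def)
  show ?thesis unfolding Uniq_def using unique restriction A B AB iso by blast
qed

end
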